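(* Let $n\ge 3$ be an integer and let $$Q_{2^n}=\langle a,b\mid a^{2^{n-2}}=b^2,\ a^{2^{n-1}}=1,\ b^{-1}ab=a^{-1}\rangle$$ be the generalized quaternion group of order $2^n$. Then $$\operatorname{cdeg}(Q_{2^n})=\frac{2^{n-2}+n}{2^{n-1}+n-1}.$$
   Context: For a finite group $G$, let $L(G)$ be the set of all subgroups of $G$ and $C(G)$ the set of all cyclic subgroups of $G$. The cyclicity degree of $G$ is $\operatorname{cdeg}(G)=|C(G)|/|L(G)|$. *)

theory Defs
  imports Complex_Main "HOL-Algebra.Algebra"
begin

definition subgroups_of :: "('a, 'b) monoid_scheme \<Rightarrow> 'a set set" where
  "subgroups_of G = {H. subgroup H G}"

definition cyclic_subgroups_of :: "('a, 'b) monoid_scheme \<Rightarrow> 'a set set" where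
  "cyclic_subgroups_of G = {H. subgroup H G \<and> cyclic_group (G\<lparr>carrier := H\<rparr>)}"

text \<open>The quotient is meaningful for finite groups only, since \<open>card\<close> is 0 on infinite sets.\<close>

definition cdeg :: "('a, 'b) monoid_scheme \<Rightarrow> real" where
  "cdeg G = real (card (cyclic_subgroups_of G)) / real (card (subgroups_of G))"


section \<open>Groups given by generators and relations\<close>

text \<open>
  The generators are all elements of the type \<open>'g\<close>. The letter \<open>(x, True)\<close> stands for the
  generator \<open>x\<close>, and \<open>(x, False)\<close> for its formal inverse. A pair \<open>(r, s)\<close> in \<open>R\<close> is the
  relation \<open>r = s\<close>. The relation \<open>pres_eq R\<close> is the least congruence on words that contains
  \<open>R\<close> and the cancellation of inverse letters, so its classes form the quotient of the free
  group on \<open>'g\<close> by the normal closure of the elements \<open>r s\<inverse>\<close>.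
\<close>

type_synonym 'g word = "('g \<times> bool) list"

inductive pres_eq :: "('g word \<times> 'g word) set \<Rightarrow> 'g word \<Rightarrow> 'g word \<Rightarrow> bool"
  for R :: "('g word \<times> 'g word) set" where
  pres_refl: "pres_eq R u u"
| pres_sym: "pres_eq R u v \<Longrightarrow> pres_eq R v u"
| pres_trans: "pres_eq R u v \<Longrightarrow> pres_eq R v w \<Longrightarrow> pres_eq R u w"
| pres_cancel: "pres_eq R (u @ [(x, e), (x, \<not> e)] @ v) (u @ v)"
| pres_rel: "(r, s) \<in> R \<Longrightarrow> pres_eq R (u @ r @ v) (u @ s @ v)"

definition pres_class :: "('g word \<times> 'g word) set \<Rightarrow> 'g word \<Rightarrow> 'g word set" where
  "pres_class R u = {v. pres_eq R u v}"

definition presented_group :: "('g word \<times> 'g word) set \<Rightarrow> 'g word set monoid" where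
  "presented_group R =
    \<lparr>carrier = range (pres_class R),
     monoid.mult = (\<lambda>U V. \<Union>u\<in>U. \<Union>v\<in>V. pres_class R (u @ v)),
     one = pres_class R []\<rparr>"

definition word_inv :: "'g word \<Rightarrow> 'g word" where
  "word_inv u = rev (map (\<lambda>(x, e). (x, \<not> e)) u)"

lemma pres_eq_append_left: "pres_eq R u v \<Longrightarrow> pres_eq R (w @ u) (w @ v)"
proof (induction rule: pres_eq.induct)
  case (pres_cancel u x e v)
  show ?case using pres_eq.pres_cancel[of R "w @ u" x e v] by simp
next
  case (pres_rel r s u v)
  then show ?case using pres_eq.pres_rel[of r s R "w @ u" v] by simp
qed (rule pres_refl, erule pres_sym, erule (1) pres_trans)

lemma pres_eq_append_right: "pres_eq R u v \<Longrightarrow> pres_eq R (u @ w) (v @ w)"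
proof (induction rule: pres_eq.induct)
  case (pres_cancel u x e v)
  show ?case using pres_eq.pres_cancel[of R u x e "v @ w"] by simp
next
  case (pres_rel r s u v)
  then show ?case using pres_eq.pres_rel[of r s R u "v @ w"] by simp
qed (rule pres_refl, erule pres_sym, erule (1) pres_trans)

lemma pres_eq_append:
  "pres_eq R u u' \<Longrightarrow> pres_eq R v v' \<Longrightarrow> pres_eq R (u @ v) (u' @ v')"
  by (rule pres_trans[OF pres_eq_append_right pres_eq_append_left])

lemma pres_class_eq_iff: "pres_class R u = pres_class R v \<longleftrightarrow> pres_eq R u v"
proof
  assume "pres_class R u = pres_class R v"
  then have "v \<in> pres_class R u" by (simp add: pres_class_def pres_refl)
  then show "pres_eq R u v" by (simp add: pres_class_def)
next
  assume "pres_eq R u v"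
  then show "pres_class R u = pres_class R v"
    unfolding pres_class_def
    by (intro Collect_cong iffI) (metis pres_sym pres_trans)+
qed

lemma pres_class_self: "u \<in> pres_class R u"
  by (simp add: pres_class_def pres_refl)

lemma presented_group_mult:
  "pres_class R u \<otimes>\<^bsub>presented_group R\<^esub> pres_class R v = pres_class R (u @ v)"
proof -
  have "pres_class R (u' @ v') = pres_class R (u @ v)"
    if "u' \<in> pres_class R u" "v' \<in> pres_class R v" for u' v'
    unfolding pres_class_eq_iff
    by (rule pres_sym, rule pres_eq_append) (use that in \<open>simp_all add: pres_class_def\<close>)
  then have "(\<Union>u'\<in>pres_class R u. \<Union>v'\<in>pres_class R v. pres_class R (u' @ v'))
      = (\<Union>u'\<in>pres_class R u. \<Union>v'\<in>pres_class R v. pres_class R (u @ v))"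
    by (intro SUP_cong refl)
  also have "\<dots> = pres_class R (u @ v)"
    using pres_class_self[of u R] pres_class_self[of v R] by blast
  finally show ?thesis
    by (simp add: presented_group_def)
qed

lemma word_inv_left: "pres_eq R (word_inv u @ u) []"
proof (induction u)
  case Nil
  show ?case by (simp add: word_inv_def pres_refl)
next
  case (Cons l u)
  obtain x e where l: "l = (x, e)" by fastforce
  have "pres_eq R (word_inv u @ [(x, \<not> e), (x, \<not> \<not> e)] @ u) (word_inv u @ u)"
    by (rule pres_cancel)
  then show ?case
    using pres_trans[OF _ Cons.IH] by (simp add: l word_inv_def)
qed

lemma group_presented_group: "group (presented_group R)"
proof (rule groupI)
  fix x assume "x \<in> carrier (presented_group R)"
  then obtain u where "x = pres_class R u" by (auto simp: presented_group_def)
  moreover have "pres_class R (word_inv u) \<in> carrier (presented_group R)"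
    by (simp add: presented_group_def)
  moreover have "pres_class R (word_inv u) \<otimes>\<^bsub>presented_group R\<^esub> pres_class R u
      = \<one>\<^bsub>presented_group R\<^esub>"
    by (simp only: presented_group_mult)
      (simp add: presented_group_def pres_class_eq_iff word_inv_left)
  ultimately show "\<exists>y\<in>carrier (presented_group R).
      y \<otimes>\<^bsub>presented_group R\<^esub> x = \<one>\<^bsub>presented_group R\<^esub>"
    by blast
next
  fix x y z
  assume "x \<in> carrier (presented_group R)" "y \<in> carrier (presented_group R)"
    "z \<in> carrier (presented_group R)"
  then obtain u v w
    where "x = pres_class R u" "y = pres_class R v" "z = pres_class R w"
    by (auto simp: presented_group_def)
  then show "x \<otimes>\<^bsub>presented_group R\<^esub> y \<otimes>\<^bsub>presented_group R\<^esub> z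
      = x \<otimes>\<^bsub>presented_group R\<^esub> (y \<otimes>\<^bsub>presented_group R\<^esub> z)"
    by (simp add: presented_group_mult)
next
  fix x assume "x \<in> carrier (presented_group R)"
  then obtain u where u: "x = pres_class R u" by (auto simp: presented_group_def)
  have one: "\<one>\<^bsub>presented_group R\<^esub> = pres_class R []"
    by (simp add: presented_group_def)
  show "\<one>\<^bsub>presented_group R\<^esub> \<otimes>\<^bsub>presented_group R\<^esub> x = x"
    unfolding u one presented_group_mult by simp
next
  fix x y assume "x \<in> carrier (presented_group R)" "y \<in> carrier (presented_group R)"
  then obtain u v where u: "x = pres_class R u" and v: "y = pres_class R v"
    by (auto simp: presented_group_def)
  show "x \<otimes>\<^bsub>presented_group R\<^esub> y \<in> carrier (presented_group R)"
    unfolding u v presented_group_mult by (simp add: presented_group_def)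
next
  show "\<one>\<^bsub>presented_group R\<^esub> \<in> carrier (presented_group R)"
    by (simp add: presented_group_def)
qed


section \<open>The generalized quaternion groups\<close>

datatype quat_gen = Gen_a | Gen_b

abbreviation word_a :: "quat_gen word" where "word_a \<equiv> [(Gen_a, True)]"
abbreviation word_b :: "quat_gen word" where "word_b \<equiv> [(Gen_b, True)]"

abbreviation word_pow :: "'g word \<Rightarrow> nat \<Rightarrow> 'g word" where
  "word_pow u k \<equiv> concat (replicate k u)"

text \<open>\<open>gen_quaternion n\<close> has order \<open>2 ^ n\<close> and is meant for \<open>n \<ge> 3\<close>.\<close>

definition gen_quaternion :: "nat \<Rightarrow> quat_gen word set monoid" where
  "gen_quaternion n = presented_group
    {(word_pow word_a (2 ^ (n - 2)), word_pow word_b 2),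
     (word_pow word_a (2 ^ (n - 1)), []),
     (word_inv word_b @ word_a @ word_b, word_inv word_a)}"

end

theory Submission
  imports Defs
begin

text \<open>
  With \<open>n = s + 2\<close>, every element of the group is \<open>a\<^sup>i\<close> or \<open>a\<^sup>i b\<close> with \<open>i\<close> determined modulo
  \<open>2\<^bsup>s+1\<^esup>\<close>; that the relations force no further collapse is seen from an action of words
  on pairs \<open>(i, e)\<close>. The exponents \<open>i\<close> with \<open>a\<^sup>i \<in> H\<close> are the multiples of some \<open>2\<^sup>k\<close>, \<open>k \<le> s + 1\<close>.
  If \<open>H\<close> also contains some \<open>a\<^sup>r b\<close>, it contains its square \<open>a\<^bsup>2^s\<^esup>\<close>, so \<open>k \<le> s\<close>, and \<open>r\<close>
  matters only modulo \<open>2\<^sup>k\<close>. This gives \<open>(s + 2) + (2\<^bsup>s+1\<^esup> - 1)\<close> subgroups. As \<open>a\<^sup>r b\<close> has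
  order 4, those of the second kind are cyclic only for \<open>k = s\<close>, which gives \<open>(s + 2) + 2\<^sup>s\<close>
  cyclic subgroups.
\<close>

section \<open>Subgroups of the integers and divisors of powers of two\<close>

text \<open>The generator is the least positive member, which exists because of \<open>m\<close>.
  The remainder of any member on division by it lies in \<open>I\<close> again and is smaller, hence
  zero.\<close>

lemma int_subgroup_eq_multiples:
  fixes I :: "int set"
  assumes diff: "\<And>i j. i \<in> I \<Longrightarrow> j \<in> I \<Longrightarrow> i - j \<in> I"
    and m: "m \<in> I" "m > 0"
  obtains d where "d > 0" "\<And>i. i \<in> I \<longleftrightarrow> d dvd i"
proof -
  have zero: "0 \<in> I" using diff[OF m(1) m(1)] by simp
  have minus: "- i \<in> I" if "i \<in> I" for i using diff[OF zero that] by simp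
  have add: "i + j \<in> I" if "i \<in> I" "j \<in> I" for i j using diff[OF that(1) minus[OF that(2)]] by simp
  define d where "d = (LEAST d::nat. d > 0 \<and> int d \<in> I)"
  have "nat m > 0 \<and> int (nat m) \<in> I" using m by simp
  then have d: "d > 0" "int d \<in> I"
    unfolding d_def using LeastI[of "\<lambda>d. d > 0 \<and> int d \<in> I"] by blast+
  have least: "d \<le> c" if "c > 0" "int c \<in> I" for c
    unfolding d_def using that by (simp add: Least_le)
  have natmult: "int d * int c \<in> I" for c
    by (induction c) (auto simp: zero algebra_simps intro: add d)
  have mult: "int d * c \<in> I" for c
  proof (cases "c \<ge> 0")
    case True
    then show ?thesis using natmult[of "nat c"] by simp
  next
    case False
    then show ?thesis using minus[OF natmult[of "nat (- c)"]] by simp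
  qed
  have "int d dvd i" if "i \<in> I" for i
  proof (rule ccontr)
    assume "\<not> int d dvd i"
    then have "i mod int d \<noteq> 0" by (simp add: dvd_eq_mod_eq_0)
    moreover have "i mod int d \<ge> 0" "i mod int d < int d" using d by simp_all
    moreover have "i mod int d \<in> I"
      using diff[OF that mult[of "i div int d"]] by (simp add: minus_mult_div_eq_mod)
    ultimately show False using least[of "nat (i mod int d)"] by simp
  qed
  then show ?thesis using that[of "int d"] d mult by (auto simp: dvd_def)
qed

lemma two_power_dvd_iff: "(2 :: int) ^ k dvd 2 ^ l \<longleftrightarrow> k \<le> l"
  by (simp add: dvd_power_iff)

lemma dvd_two_power_int:
  fixes d :: int
  assumes "d > 0" "d dvd 2 ^ t"
  obtains k where "k \<le> t" "d = 2 ^ k"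
  using divides_primepow[OF _ assms(2)] assms(1)
  by (metis normalize_int_def abs_of_pos prime_int_numeral_eq two_is_prime_nat)

section \<open>Quaternion coordinates and the two families of subgroups\<close>

text \<open>\<open>g i e\<close> stands for \<open>a\<^sup>i b\<^sup>e\<close>, so that \<open>a\<close> has order \<open>2\<^bsup>s+1\<^esup>\<close> and \<open>b\<^sup>2 = a\<^bsup>2^s\<^esup>\<close>.\<close>

locale quaternion_coords = group G for G (structure) +
  fixes g :: "int \<Rightarrow> bool \<Rightarrow> 'a" and s :: nat
  assumes carrier_iff: "x \<in> carrier G \<longleftrightarrow> (\<exists>i e. x = g i e)"
    and g_eq_iff: "g i e = g j f \<longleftrightarrow> e = f \<and> 2 ^ (s + 1) dvd i - j"
    and g_mult: "g i e \<otimes> g j f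
      = g (i + (if e then - j else j) + (if e \<and> f then 2 ^ s else 0)) (e \<noteq> f)"
begin

text \<open>For \<open>k\<close> at most \<open>s + 1\<close> this is the cyclic subgroup generated
  by \<open>a^(2^k)\<close>, of order \<open>2^(s+1-k)\<close>. The value \<open>k = s + 1\<close>
  gives the trivial subgroup.\<close>

definition rotations :: "nat \<Rightarrow> 'a set" where
  "rotations k = {g i False | i. 2 ^ k dvd i}"

text \<open>For \<open>k\<close> at most \<open>s\<close> this is the subgroup generated by
  \<open>a^(2^k)\<close> and \<open>a^r b\<close>, of order \<open>2^(s+2-k)\<close>.\<close>

definition dicyclic :: "nat \<Rightarrow> int \<Rightarrow> 'a set" where
  "dicyclic k r = rotations k \<union> {g i True | i. 2 ^ k dvd i - r}"

lemma g_closed [simp]: "g i e \<in> carrier G"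
  using carrier_iff by blast

lemma g_one: "g 0 False = \<one>"
proof -
  \<comment> \<open>An idempotent of a group is its identity.\<close>
  have "g 0 False \<otimes> g 0 False = g 0 False" by (simp add: g_mult)
  then show ?thesis by (metis g_closed l_cancel_one)
qed

text \<open>In the case of \<open>a^i b\<close>, the two exponents \<open>i\<close> cancel because
  \<open>b\<close> inverts \<open>a\<close>. The shift by \<open>2^s\<close> and the factor
  \<open>b^2\<close> together contribute \<open>2^(s+1)\<close>, the exponent of the
  identity.\<close>

lemma inv_g: "inv g i e = g (if e then i + 2 ^ s else - i) e"
proof (rule inv_equality)
  show "g (if e then i + 2 ^ s else - i) e \<otimes> g i e = \<one>"
    by (auto simp: g_mult g_one[symmetric] g_eq_iff)
qed simp_all

lemma g_rotation_power: "g i False [^] (c :: int) = g (c * i) False"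
proof -
  have nat_case: "g i False [^] (c :: nat) = g (int c * i) False" for c
    by (induction c) (simp_all add: g_one g_mult algebra_simps)
  show ?thesis
  proof (cases c rule: int_cases2)
    case (nonneg n)
    then show ?thesis by (simp only: int_pow_int nat_case)
  next
    case (nonpos n)
    then show ?thesis by (simp only: int_pow_neg_int[OF g_closed] nat_case inv_g if_False mult_minus_left)
  qed
qed

text \<open>An element fixes its exponent only modulo \<open>2^(s+1)\<close>. Divisibility by
  \<open>2^k\<close> does not depend on the chosen exponent, since \<open>2^k\<close> divides
  \<open>2^(s+1)\<close>.\<close>

lemma rotation_in_rotations:
  assumes "k \<le> s + 1"
  shows "g i e \<in> rotations k \<longleftrightarrow> \<not> e \<and> 2 ^ k dvd i"
proof -
  have "2 ^ k dvd i" if "2 ^ k dvd j" "2 ^ (s + 1) dvd i - j" for j :: int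
  proof -
    have "2 ^ k dvd i - j" using that(2) assms by (meson dvd_trans le_imp_power_dvd)
    then show ?thesis using that(1) by (metis dvd_diff_left_iff)
  qed
  then show ?thesis unfolding rotations_def by (auto simp: g_eq_iff intro!: exI[of _ i])
qed

lemma g_in_dicyclic:
  assumes "k \<le> s + 1"
  shows "g i e \<in> dicyclic k r \<longleftrightarrow> (if e then 2 ^ k dvd i - r else 2 ^ k dvd i)"
proof -
  have "2 ^ k dvd i - r" if "2 ^ k dvd j - r" "2 ^ (s + 1) dvd i - j" for j :: int
  proof -
    have "2 ^ k dvd i - j" using that(2) assms by (meson dvd_trans le_imp_power_dvd)
    then show ?thesis using dvd_add[OF _ that(1), of "i - j"] by simp
  qed
  then show ?thesis unfolding dicyclic_def Un_iff rotation_in_rotations[OF assms]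
    by (auto simp: g_eq_iff intro!: exI[of _ i])
qed

lemma subgroup_rotations:
  assumes "k \<le> s + 1"
  shows "subgroup (rotations k) G"
proof (rule subgroupI)
  show "rotations k \<subseteq> carrier G" by (auto simp: rotations_def)
  show "rotations k \<noteq> {}" by (auto simp: rotations_def)
  show "inv x \<in> rotations k" if "x \<in> rotations k" for x
    using that by (auto simp: rotations_def inv_g)
  show "x \<otimes> y \<in> rotations k" if "x \<in> rotations k" "y \<in> rotations k" for x y
    using that by (auto simp: rotations_def g_mult intro: dvd_add)
qed

lemma dicyclic_cases:
  assumes "x \<in> dicyclic k r"
  obtains i where "x = g i False" "2 ^ k dvd i" | i where "x = g i True" "2 ^ k dvd i - r"
  using assms unfolding dicyclic_def rotations_def by blast

text \<open>Inverses and products of elements \<open>a^i b\<close> bring in the exponent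
  \<open>2^s\<close>. The bound on \<open>k\<close> makes \<open>2^k\<close> divide it, so these
  terms stay in the set.\<close>

lemma subgroup_dicyclic:
  assumes "k \<le> s"
  shows "subgroup (dicyclic k r) G"
proof (rule subgroupI)
  have k: "k \<le> s + 1" using assms by simp
  have h: "(2 :: int) ^ k dvd 2 ^ s" using assms by (rule le_imp_power_dvd)
  show "dicyclic k r \<subseteq> carrier G" by (auto simp: dicyclic_def rotations_def)
  show "dicyclic k r \<noteq> {}" by (auto simp: dicyclic_def rotations_def)
  show "inv x \<in> dicyclic k r" if "x \<in> dicyclic k r" for x
    using that
  proof (cases rule: dicyclic_cases)
    case (1 i)
    then show ?thesis by (simp add: inv_g g_in_dicyclic[OF k])
  next
    case (2 i)
    have "2 ^ k dvd (i - r) + 2 ^ s" using 2(2) h by (rule dvd_add)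
    then show ?thesis using 2 by (simp add: inv_g g_in_dicyclic[OF k] algebra_simps)
  qed
  show "x \<otimes> y \<in> dicyclic k r" if x: "x \<in> dicyclic k r" and y: "y \<in> dicyclic k r" for x y
    using x
  proof (cases rule: dicyclic_cases)
    case x: (1 i)
    show ?thesis using y
    proof (cases rule: dicyclic_cases)
      case (1 j)
      then show ?thesis using x by (simp add: g_mult g_in_dicyclic[OF k])
    next
      case (2 j)
      then show ?thesis using x dvd_add[of "2 ^ k" i "j - r"]
        by (simp add: g_mult g_in_dicyclic[OF k] algebra_simps)
    qed
  next
    case x: (2 i)
    show ?thesis using y
    proof (cases rule: dicyclic_cases)
      case (1 j)
      then show ?thesis using x dvd_diff[of "2 ^ k" "i - r" j]
        by (simp add: g_mult g_in_dicyclic[OF k] algebra_simps)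
    next
      case (2 j)
      then show ?thesis using x dvd_add[OF dvd_diff[of "2 ^ k" "i - r" "j - r"] h]
        by (simp add: g_mult g_in_dicyclic[OF k] algebra_simps)
    qed
  qed
qed

text \<open>This allows \<open>r\<close> to be normalised to the representative in
  \<open>{0..<2 ^ k}\<close> by which the subgroups are counted.\<close>

lemma dicyclic_mod: "dicyclic k (r mod 2 ^ k) = dicyclic k r"
proof -
  have "2 ^ k dvd i - r mod 2 ^ k \<longleftrightarrow> 2 ^ k dvd i - r" for i
    by (simp add: dvd_eq_mod_eq_0 mod_diff_right_eq)
  then show ?thesis by (simp add: dicyclic_def)
qed

section \<open>Classification and number of the subgroups\<close>

lemma subgroup_cases:
  assumes H: "subgroup H G"
  obtains k where "k \<le> s + 1" "H = rotations k"
  | k r where "k \<le> s" "r \<in> {0..<2 ^ k}" "H = dicyclic k r"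
proof -
  interpret H: subgroup H G by (rule H)
  have diff: "i - j \<in> {i. g i False \<in> H}" if "i \<in> {i. g i False \<in> H}" "j \<in> {i. g i False \<in> H}" for i j
    using H.m_closed[OF _ H.m_inv_closed, of "g i False" "g j False"] that by (simp add: inv_g g_mult)
  \<comment> \<open>The exponent set of \<open>H\<close> needs a positive member;
    \<open>2^(s+1)\<close> is one, as it is an exponent of the identity. It also forces the
    generator \<open>d\<close> to be a power of two.\<close>
  have "g (2 ^ (s + 1)) False = g 0 False" by (simp add: g_eq_iff)
  then have "2 ^ (s + 1) \<in> {i. g i False \<in> H}" by (simp add: g_one)
  then obtain d where d: "d > 0" "\<And>i. i \<in> {i. g i False \<in> H} \<longleftrightarrow> d dvd i"
    using int_subgroup_eq_multiples[OF diff, of "2 ^ (s + 1)"] by auto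
  then have "d dvd 2 ^ (s + 1)" using \<open>2 ^ (s + 1) \<in> _\<close> by blast
  then obtain k where k: "k \<le> s + 1" "d = 2 ^ k"
    using dvd_two_power_int d(1) by blast
  have rot: "g i False \<in> H \<longleftrightarrow> 2 ^ k dvd i" for i
    using d(2)[of i] k(2) by simp
  show ?thesis
  proof (cases "\<exists>r. g r True \<in> H")
    case False
    have "x \<in> H \<longleftrightarrow> x \<in> rotations k" for x
    proof (cases "x \<in> carrier G")
      case True
      then obtain i e where "x = g i e" using carrier_iff by blast
      then show ?thesis using False rot by (cases e) (auto simp: rotation_in_rotations[OF k(1)])
    next
      case False
      then show ?thesis using H.subset by (auto simp: rotations_def)
    qed
    then show ?thesis using that(1) k(1) by blast
  next
    case True
    then obtain r where r: "g r True \<in> H" by blast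
    have "g (2 ^ s) False \<in> H" using H.m_closed[OF r r] by (simp add: g_mult)
    then have "(2 :: int) ^ k dvd 2 ^ s" using rot by blast
    then have ks: "k \<le> s" by (simp add: two_power_dvd_iff)
    \<comment> \<open>Multiplication by \<open>a^r b\<close> or its inverse exchanges membership of
      \<open>a^i b\<close> with that of \<open>a^(i-r)\<close>, which \<open>rot\<close>
      decides.\<close>
    have reflections: "g i True \<in> H \<longleftrightarrow> 2 ^ k dvd i - r" for i
    proof
      assume "g i True \<in> H"
      then have "g i True \<otimes> inv g r True \<in> H" using r by simp
      then have "g (i - r) False \<in> H" by (simp add: inv_g g_mult)
      then show "2 ^ k dvd i - r" by (simp add: rot)
    next
      assume "2 ^ k dvd i - r"
      then have "g (i - r) False \<otimes> g r True \<in> H" using r rot by (blast intro: H.m_closed)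
      then show "g i True \<in> H" by (simp add: g_mult)
    qed
    have "x \<in> H \<longleftrightarrow> x \<in> dicyclic k r" for x
    proof (cases "x \<in> carrier G")
      case True
      then obtain i e where "x = g i e" using carrier_iff by blast
      then show ?thesis using reflections rot by (cases e) (auto simp: g_in_dicyclic[OF k(1)])
    next
      case False
      then show ?thesis using H.subset by (auto simp: dicyclic_def rotations_def)
    qed
    then have "H = dicyclic k (r mod 2 ^ k)" by (auto simp: dicyclic_mod)
    then show ?thesis using that(2)[OF ks, of "r mod 2 ^ k"] by simp
  qed
qed

definition dicyclic_index :: "(nat \<times> int) set" where
  "dicyclic_index = Sigma {..s} (\<lambda>k. {0..<2 ^ k})"

lemma subgroups_of_eq:
  "subgroups_of G = rotations ` {..s + 1} \<union> (\<lambda>(k, r). dicyclic k r) ` dicyclic_index"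
proof (rule Set.set_eqI)
  fix H
  show "H \<in> subgroups_of G \<longleftrightarrow>
      H \<in> rotations ` {..s + 1} \<union> (\<lambda>(k, r). dicyclic k r) ` dicyclic_index"
  proof
    assume "H \<in> subgroups_of G"
    then have "subgroup H G" by (simp add: subgroups_of_def)
    then show "H \<in> rotations ` {..s + 1} \<union> (\<lambda>(k, r). dicyclic k r) ` dicyclic_index"
      by (cases rule: subgroup_cases) (force simp: dicyclic_index_def)+
  qed (auto simp: subgroups_of_def dicyclic_index_def intro: subgroup_rotations subgroup_dicyclic)
qed

lemma inj_on_rotations: "inj_on rotations {..s + 1}"
proof (rule inj_onI)
  fix k l assume kl: "k \<in> {..s + 1}" "l \<in> {..s + 1}" and eq: "rotations k = rotations l"
  have "(2 :: int) ^ k dvd i \<longleftrightarrow> 2 ^ l dvd i" for i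
    using rotation_in_rotations[of k i False] rotation_in_rotations[of l i False] kl eq by simp
  \<comment> \<open>Testing the two generators gives divisibility in both directions.\<close>
  from this[of "2 ^ k"] this[of "2 ^ l"] show "k = l"
    by (simp add: two_power_dvd_iff)
qed

lemma card_rotations: "card (rotations ` {..s + 1}) = s + 2"
  using card_image[OF inj_on_rotations] by simp

lemma inj_on_dicyclic: "inj_on (\<lambda>(k, r). dicyclic k r) dicyclic_index"
proof (rule inj_onI, clarify)
  fix k l r q
  assume kr: "(k, r) \<in> dicyclic_index" and lq: "(l, q) \<in> dicyclic_index"
    and eq: "dicyclic k r = dicyclic l q"
  then have bounds: "k \<le> s + 1" "l \<le> s + 1" "0 \<le> r" "r < 2 ^ k" "0 \<le> q" "q < 2 ^ l"
    by (auto simp: dicyclic_index_def)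
  have "(2 :: int) ^ k dvd i \<longleftrightarrow> 2 ^ l dvd i" for i
    using g_in_dicyclic[of k i False r] g_in_dicyclic[of l i False q] bounds eq by simp
  from this[of "2 ^ k"] this[of "2 ^ l"] have kl: "k = l"
    by (simp add: two_power_dvd_iff)
  have "2 ^ k dvd r - q"
    using g_in_dicyclic[of k r True r] g_in_dicyclic[of l r True q] bounds eq kl by simp
  then have "r mod 2 ^ k = q mod 2 ^ k" by (simp add: mod_eq_dvd_iff)
  then show "k = l \<and> r = q" using bounds kl by simp
qed

text \<open>The element \<open>a^r b\<close> separates the two subgroups.\<close>

lemma rotations_neq_dicyclic:
  assumes "k \<le> s + 1" "l \<le> s + 1"
  shows "rotations k \<noteq> dicyclic l r"
  using rotation_in_rotations[OF assms(1), of r True] g_in_dicyclic[OF assms(2), of r True r]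
  by auto

text \<open>The second family is counted by the geometric sum \<open>2^(s+1) - 1\<close>; adding 1
  on the left avoids subtraction of natural numbers.\<close>

lemma card_subgroups_of: "card (subgroups_of G) + 1 = s + 2 + 2 ^ (s + 1)"
proof -
  have "card dicyclic_index = (\<Sum>k\<in>{..s}. 2 ^ k)"
    unfolding dicyclic_index_def by (subst card_SigmaI) (auto simp: nat_power_eq)
  also have "\<dots> + 1 = 2 ^ (s + 1)"
    by (induction s) auto
  finally have idx: "card dicyclic_index + 1 = 2 ^ (s + 1)" .
  have fin: "finite dicyclic_index" by (simp add: dicyclic_index_def)
  have "rotations ` {..s + 1} \<inter> (\<lambda>(k, r). dicyclic k r) ` dicyclic_index = {}"
    using rotations_neq_dicyclic by (fastforce simp: dicyclic_index_def)
  then have "card (subgroups_of G) = (s + 2) + card dicyclic_index"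
    using fin by (simp add: subgroups_of_eq card_Un_disjoint card_rotations card_image inj_on_dicyclic
        del: add_Suc_right One_nat_def)
  then show ?thesis using idx by simp
qed

section \<open>Cyclic subgroups and the cyclicity degree\<close>

text \<open>Powers computed in the subgroup agree with powers in \<open>G\<close>, so the search for
  a generator can be carried out in the coordinates of \<open>G\<close>.\<close>

lemma cyclic_subgroup_iff:
  assumes "subgroup H G"
  shows "cyclic_group (G\<lparr>carrier := H\<rparr>) \<longleftrightarrow> (\<exists>x\<in>H. H = range (\<lambda>n::int. x [^] n))"
proof -
  interpret K: group "G\<lparr>carrier := H\<rparr>" using subgroup_imp_group[OF assms] .
  show ?thesis unfolding K.cyclic_group by (simp add: int_pow_consistent[OF assms, symmetric])
qed

lemma cyclic_rotations:
  assumes "k \<le> s + 1"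
  shows "cyclic_group (G\<lparr>carrier := rotations k\<rparr>)"
proof -
  have "rotations k = range (\<lambda>n::int. g (2 ^ k) False [^] n)"
    unfolding g_rotation_power rotations_def by (auto simp: dvd_def mult.commute)
  moreover have "g (2 ^ k) False \<in> rotations k" by (auto simp: rotations_def)
  ultimately show ?thesis using cyclic_subgroup_iff[OF subgroup_rotations[OF assms]] by blast
qed

text \<open>The square of \<open>a^r b\<close> is \<open>a^(2^s)\<close> whatever \<open>r\<close>
  is, since the two exponents \<open>r\<close> cancel.\<close>

lemma reflection_power_even: "g r True [^] (2 * c :: int) = g (c * 2 ^ s) False"
proof -
  have "g r True [^] (2 * c) = (g r True [^] (2 :: int)) [^] c" by (simp add: int_pow_pow)
  also have "g r True [^] (2 :: int) = g r True [^] (2 :: nat)" by (simp add: int_pow_def2)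
  also have "\<dots> = g (2 ^ s) False" by (simp add: numeral_2_eq_2 g_mult)
  finally show ?thesis by (simp add: g_rotation_power)
qed

lemma cyclic_dicyclic_iff:
  assumes k: "k \<le> s"
  shows "cyclic_group (G\<lparr>carrier := dicyclic k r\<rparr>) \<longleftrightarrow> k = s"
proof
  assume "cyclic_group (G\<lparr>carrier := dicyclic k r\<rparr>)"
  then have "\<exists>x\<in>dicyclic k r. dicyclic k r = range (\<lambda>n::int. x [^] n)"
    by (rule cyclic_subgroup_iff[OF subgroup_dicyclic[OF k], THEN iffD1])
  then obtain x where x: "x \<in> dicyclic k r" "dicyclic k r = range (\<lambda>n::int. x [^] n)"
    by (elim bexE)
  have mem: "g r True \<in> dicyclic k r" "g (2 ^ k) False \<in> dicyclic k r"
    using k by (simp_all add: g_in_dicyclic)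
  from x(1) show "k = s"
  proof (cases rule: dicyclic_cases)
    case (1 i)
    \<comment> \<open>A generator \<open>a^i\<close> would yield only powers of \<open>a\<close>,
      but \<open>a^r b\<close> belongs to the subgroup.\<close>
    then have "\<exists>j. g r True = g j False" using mem(1) unfolding x(2) by (auto simp: g_rotation_power)
    then show ?thesis by (simp add: g_eq_iff)
  next
    case (2 i)
    \<comment> \<open>A generator \<open>a^i b\<close> lies in \<open>dicyclic s i\<close>, a
      subgroup of order 4. Hence so does everything it generates, in particular
      \<open>a^(2^k)\<close>, which forces \<open>k\<close> up to \<open>s\<close>.\<close>
    have "x \<in> dicyclic s i" using 2 by (simp add: g_in_dicyclic)
    then have "range (\<lambda>n::int. x [^] n) \<subseteq> dicyclic s i"
      using subgroup_int_pow_closed[OF subgroup_dicyclic[OF order_refl]] by blast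
    then have "g (2 ^ k) False \<in> dicyclic s i" using mem(2) x(2) by blast
    then have "(2 :: int) ^ s dvd 2 ^ k" by (simp add: g_in_dicyclic)
    then show ?thesis using k by (simp add: two_power_dvd_iff)
  qed
next
  assume ks: "k = s"
  have mem: "g r True \<in> dicyclic s r" by (simp add: g_in_dicyclic)
  \<comment> \<open>Even powers of \<open>a^r b\<close> give the rotations by multiples of
    \<open>2^s\<close>, odd powers give the remaining elements.\<close>
  have "x \<in> range (\<lambda>n::int. g r True [^] n)" if "x \<in> dicyclic s r" for x
    using that
  proof (cases rule: dicyclic_cases)
    case (1 i)
    then obtain c where "i = c * 2 ^ s" by (auto simp: dvd_def mult.commute)
    then have "x = g r True [^] (2 * c)" using 1 by (simp only: reflection_power_even)
    then show ?thesis by blast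
  next
    case (2 i)
    then obtain c where c: "i - r = 2 ^ s * c" by (auto simp: dvd_def)
    have "g r True [^] (2 * c + 1) = g (c * 2 ^ s) False \<otimes> g r True"
      by (simp only: int_pow_mult[OF g_closed] reflection_power_even int_pow_1[OF g_closed])
    also have "\<dots> = x" using 2 c by (simp add: g_mult algebra_simps)
    finally show ?thesis by blast
  qed
  moreover have "range (\<lambda>n::int. g r True [^] n) \<subseteq> dicyclic s r"
    using subgroup_int_pow_closed[OF subgroup_dicyclic[OF order_refl] mem] by blast
  ultimately have "dicyclic s r = range (\<lambda>n::int. g r True [^] n)" by blast
  then have "\<exists>x\<in>dicyclic k r. dicyclic k r = range (\<lambda>n::int. x [^] n)"
    using mem unfolding ks by (intro bexI)
  then show "cyclic_group (G\<lparr>carrier := dicyclic k r\<rparr>)"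
    by (rule cyclic_subgroup_iff[OF subgroup_dicyclic[OF k], THEN iffD2])
qed

lemma cyclic_subgroups_of_eq:
  "cyclic_subgroups_of G = rotations ` {..s + 1} \<union> dicyclic s ` {0..<2 ^ s}"
proof -
  have "cyclic_subgroups_of G = {H \<in> subgroups_of G. cyclic_group (G\<lparr>carrier := H\<rparr>)}"
    by (auto simp: cyclic_subgroups_of_def subgroups_of_def)
  also have "\<dots> = rotations ` {..s + 1} \<union> dicyclic s ` {0..<2 ^ s}"
    unfolding subgroups_of_eq using cyclic_rotations
    by (auto simp: dicyclic_index_def cyclic_dicyclic_iff)
  finally show ?thesis .
qed

lemma card_cyclic_subgroups_of: "card (cyclic_subgroups_of G) = s + 2 + 2 ^ s"
proof -
  have "inj_on (dicyclic s) {0..<2 ^ s}"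
  proof (rule inj_onI)
    fix r q :: int
    assume "r \<in> {0..<2 ^ s}" "q \<in> {0..<2 ^ s}" "dicyclic s r = dicyclic s q"
    then show "r = q"
      using inj_onD[OF inj_on_dicyclic, of "(s, r)" "(s, q)"] by (simp add: dicyclic_index_def)
  qed
  moreover have "rotations ` {..s + 1} \<inter> dicyclic s ` {0..<2 ^ s} = {}"
    using rotations_neq_dicyclic by fastforce
  ultimately show ?thesis
    by (simp add: cyclic_subgroups_of_eq card_Un_disjoint card_rotations card_image nat_power_eq
        del: add_Suc_right One_nat_def)
qed

lemma cdeg_eq: "cdeg G = (2 ^ s + real (s + 2)) / (2 ^ (s + 1) + real (s + 2) - 1)"
proof -
  have "real (card (subgroups_of G)) = 2 ^ (s + 1) + real (s + 2) - 1"
    using arg_cong[OF card_subgroups_of, of real] by simp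
  then show ?thesis by (simp add: cdeg_def card_cyclic_subgroups_of)
qed

end

section \<open>Consequences of the defining relations\<close>

text \<open>Conjugation by \<open>b\<close> inverts \<open>a\<close> and therefore every power of
  \<open>a\<close>. Moving \<open>b\<close> to the right past \<open>a^j\<close> thus changes the
  sign of \<open>j\<close>, and a resulting \<open>b^2\<close> is absorbed into the power of
  \<open>a\<close>.\<close>

lemma (in group) dicyclic_relations_mult:
  assumes a: "a \<in> carrier G" and b: "b \<in> carrier G"
    and sq: "a [^] (2 ^ s :: int) = b \<otimes> b"
    and conj: "inv b \<otimes> a \<otimes> b = inv a"
  shows "(a [^] i \<otimes> (if e then b else \<one>)) \<otimes> (a [^] j \<otimes> (if f then b else \<one>))
    = a [^] (i + (if e then - j else j) + (if e \<and> f then 2 ^ s else 0 :: int))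
      \<otimes> (if e \<noteq> f then b else \<one>)"
proof -
  have "b \<otimes> (inv b \<otimes> z) = z" if "z \<in> carrier G" for z
    using b that by (simp add: m_assoc[symmetric])
  \<comment> \<open>Conjugation is a homomorphism, which carries the relation from \<open>a\<close>
    over to its powers.\<close>
  then have "(\<lambda>x. inv b \<otimes> x \<otimes> b) \<in> hom G G"
    using b by (intro homI) (simp_all add: m_assoc)
  then have "inv b \<otimes> a [^] (- j) \<otimes> b = (inv b \<otimes> a \<otimes> b) [^] (- j)"
    using hom_int_pow[of "\<lambda>x. inv b \<otimes> x \<otimes> b" G G a "- j"] a is_group by simp
  also have "\<dots> = a [^] j"
    using a by (simp add: conj int_pow_inv int_pow_neg)
  finally have "b \<otimes> (inv b \<otimes> a [^] (- j) \<otimes> b) = b \<otimes> a [^] j" by simp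
  then have swap: "b \<otimes> a [^] j = a [^] (- j) \<otimes> b"
    using a b by (simp add: m_assoc[symmetric])
  \<comment> \<open>The factor \<open>y\<close> is left open so that \<open>b\<close> and the
    identity cover both values of \<open>f\<close>.\<close>
  have push: "a [^] i \<otimes> b \<otimes> (a [^] j \<otimes> y) = a [^] (i - j) \<otimes> (b \<otimes> y)" if "y \<in> carrier G" for y
  proof -
    have "a [^] i \<otimes> b \<otimes> (a [^] j \<otimes> y) = a [^] i \<otimes> (b \<otimes> a [^] j) \<otimes> y"
      using a b that by (simp add: m_assoc)
    also have "\<dots> = (a [^] i \<otimes> a [^] (- j)) \<otimes> (b \<otimes> y)"
      unfolding swap using a b that by (simp add: m_assoc)
    also have "a [^] i \<otimes> a [^] (- j) = a [^] (i - j)"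
      using a by (simp add: int_pow_mult[symmetric])
    finally show ?thesis .
  qed
  show ?thesis
  proof (cases e)
    case False
    then show ?thesis using a b by (simp add: m_assoc[symmetric] int_pow_mult)
  next
    case True
    show ?thesis
    proof (cases f)
      case True
      then show ?thesis
        using \<open>e\<close> a b push[of b] by (simp add: sq[symmetric] int_pow_mult[symmetric])
    next
      case False
      then show ?thesis using \<open>e\<close> a b push[of \<one>] by simp
    qed
  qed
qed

lemma pres_class_in_carrier [simp]: "pres_class R u \<in> carrier (presented_group R)"
  by (simp add: presented_group_def)

lemma one_presented_group: "\<one>\<^bsub>presented_group R\<^esub> = pres_class R []"
  by (simp add: presented_group_def)

lemma pres_class_word_inv:
  "pres_class R (word_inv u) = inv\<^bsub>presented_group R\<^esub> (pres_class R u)"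
proof -
  interpret group "presented_group R" by (rule group_presented_group)
  have "pres_class R (word_inv u) \<otimes>\<^bsub>presented_group R\<^esub> pres_class R u = \<one>\<^bsub>presented_group R\<^esub>"
    by (simp add: presented_group_mult one_presented_group pres_class_eq_iff word_inv_left)
  then show ?thesis by (intro inv_equality[symmetric]) simp_all
qed

lemma pres_class_word_pow:
  "pres_class R (word_pow u k) = pres_class R u [^]\<^bsub>presented_group R\<^esub> k"
proof (induction k)
  case 0
  show ?case by (simp add: one_presented_group)
next
  case (Suc k)
  interpret group "presented_group R" by (rule group_presented_group)
  have "pres_class R (word_pow u (Suc k))
      = pres_class R u \<otimes>\<^bsub>presented_group R\<^esub> pres_class R (word_pow u k)"
    by (simp add: presented_group_mult)
  then show ?case using Suc.IH nat_pow_Suc2[of "pres_class R u" k] by simp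
qed

lemma pres_class_rel: "(r, t) \<in> R \<Longrightarrow> pres_class R r = pres_class R t"
  using pres_rel[of r t R "[]" "[]"] by (simp add: pres_class_eq_iff)

section \<open>An action of words on coordinates\<close>

text \<open>Left multiplication by a letter on the pairs \<open>(i, e)\<close> that stand for \<open>a\<^sup>i b\<^sup>e\<close>, where \<open>h\<close> is the
  exponent in \<open>b\<^sup>2 = a\<^sup>h\<close>. Inverse letters act as inverse maps over \<open>\<int>\<close>; the relations hold only
  modulo \<open>2 h\<close>.\<close>

fun letter_act :: "int \<Rightarrow> quat_gen \<times> bool \<Rightarrow> int \<times> bool \<Rightarrow> int \<times> bool" where
  "letter_act h (Gen_a, d) (i, e) = (if d then i + 1 else i - 1, e)"
| "letter_act h (Gen_b, d) (i, e) = (if d = e then h - i else - i, \<not> e)"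

abbreviation word_act :: "int \<Rightarrow> quat_gen word \<Rightarrow> int \<times> bool \<Rightarrow> int \<times> bool" where
  "word_act h u p \<equiv> foldr (letter_act h) u p"

definition coord_cong :: "int \<Rightarrow> int \<times> bool \<Rightarrow> int \<times> bool \<Rightarrow> bool" where
  "coord_cong m p q \<longleftrightarrow> snd p = snd q \<and> m dvd fst p - fst q"

lemma coord_cong_sym: "coord_cong m p q \<Longrightarrow> coord_cong m q p"
  by (auto simp: coord_cong_def dvd_diff_commute)

lemma coord_cong_trans: "coord_cong m p q \<Longrightarrow> coord_cong m q r \<Longrightarrow> coord_cong m p r"
  using dvd_add[of m "fst p - fst q" "fst q - fst r"] by (auto simp: coord_cong_def)

text \<open>A letter changes the difference of two exponents at most by its sign, provided the
  second components agree.\<close>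

lemma letter_act_cong: "coord_cong m p q \<Longrightarrow> coord_cong m (letter_act h l p) (letter_act h l q)"
  by (cases "(h, l, p)" rule: letter_act.cases; cases q)
    (auto simp: coord_cong_def dvd_diff_commute)

lemma word_act_cong: "coord_cong m p q \<Longrightarrow> coord_cong m (word_act h u p) (word_act h u q)"
  by (induction u) (auto intro: letter_act_cong)

lemma letter_act_cancel: "letter_act h (x, e) (letter_act h (x, \<not> e) p) = p"
  by (cases x; cases p) auto

text \<open>Once the relations act trivially modulo \<open>m\<close>, equal elements of the
  presented group act alike modulo \<open>m\<close>. Words that act differently therefore represent
  different elements, which gives a lower bound on the size of the group.\<close>

lemma pres_eq_word_act:
  assumes "pres_eq R u v"
    and "\<And>r t p. (r, t) \<in> R \<Longrightarrow> coord_cong m (word_act h r p) (word_act h t p)"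
  shows "coord_cong m (word_act h u p) (word_act h v p)"
  using assms(1)
proof (induction arbitrary: p rule: pres_eq.induct)
  case (pres_refl u)
  show ?case by (simp add: coord_cong_def)
next
  case (pres_cancel u x e v)
  show ?case by (simp add: letter_act_cancel coord_cong_def)
next
  case (pres_rel r t u v)
  then show ?case by (simp add: word_act_cong assms(2))
qed (blast intro: coord_cong_sym coord_cong_trans)+

lemma letter_act_pow_a: "(letter_act h (Gen_a, True) ^^ k) (i, e) = (i + int k, e)"
  by (induction k) auto

section \<open>The presented group has quaternion coordinates\<close>

lemma gen_quaternion_coords:
  "\<exists>g. quaternion_coords (gen_quaternion (s + 2)) g s"
proof -
  define R :: "(quat_gen word \<times> quat_gen word) set" where
    "R = {(word_pow word_a (2 ^ s), word_pow word_b 2), (word_pow word_a (2 ^ (s + 1)), []),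
      (word_inv word_b @ word_a @ word_b, word_inv word_a)}"
  define G where "G = presented_group R"
  define A where "A = pres_class R word_a"
  define B where "B = pres_class R word_b"
  have G_eq: "gen_quaternion (s + 2) = G"
    by (simp add: gen_quaternion_def G_def R_def)
  interpret group G unfolding G_def by (rule group_presented_group)
  have A [simp]: "A \<in> carrier G" and B [simp]: "B \<in> carrier G"
    by (simp_all add: A_def B_def G_def)
  note mult = presented_group_mult[of R, folded G_def]
  have "pres_class R (word_pow word_a (2 ^ s)) = pres_class R (word_pow word_b 2)"
    by (rule pres_class_rel) (simp only: R_def insert_iff simp_thms)
  then have "A [^]\<^bsub>G\<^esub> (2 ^ s :: nat) = B [^]\<^bsub>G\<^esub> (2 :: nat)"
    by (simp only: pres_class_word_pow A_def B_def G_def)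
  moreover have "B [^]\<^bsub>G\<^esub> (2 :: nat) = B \<otimes>\<^bsub>G\<^esub> B"
    by (simp add: numeral_2_eq_2)
  ultimately have sq: "A [^]\<^bsub>G\<^esub> (2 ^ s :: int) = B \<otimes>\<^bsub>G\<^esub> B"
    using int_pow_int[of G A "2 ^ s"] by simp
  have "pres_class R (word_pow word_a (2 ^ (s + 1))) = pres_class R []"
    by (rule pres_class_rel) (simp only: R_def insert_iff simp_thms)
  then have "A [^]\<^bsub>G\<^esub> (2 ^ (s + 1) :: nat) = \<one>\<^bsub>G\<^esub>"
    by (simp only: pres_class_word_pow A_def G_def one_presented_group)
  \<comment> \<open>This is only an upper bound for the order of \<open>a\<close>; that it is
    attained follows from the word action below.\<close>
  then have ord: "int (ord A) dvd 2 ^ (s + 1)"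
    using pow_eq_id[OF A, of "2 ^ (s + 1)"] by (metis of_nat_dvd_iff of_nat_numeral of_nat_power)
  have "pres_class R (word_inv word_b @ word_a @ word_b) = pres_class R (word_inv word_a)"
    by (rule pres_class_rel) (simp only: R_def insert_iff simp_thms)
  then have "inv\<^bsub>G\<^esub> B \<otimes>\<^bsub>G\<^esub> (A \<otimes>\<^bsub>G\<^esub> B) = inv\<^bsub>G\<^esub> A"
    by (simp only: pres_class_word_inv mult[symmetric] A_def B_def G_def)
  then have conj: "inv\<^bsub>G\<^esub> B \<otimes>\<^bsub>G\<^esub> A \<otimes>\<^bsub>G\<^esub> B = inv\<^bsub>G\<^esub> A"
    by (simp add: m_assoc)
  define g where "g i e = A [^]\<^bsub>G\<^esub> (i :: int) \<otimes>\<^bsub>G\<^esub> (if e then B else \<one>\<^bsub>G\<^esub>)" for i e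
  have g_mult: "g i e \<otimes>\<^bsub>G\<^esub> g j f
      = g (i + (if e then - j else j) + (if e \<and> f then 2 ^ s else 0)) (e \<noteq> f)" for i e j f
    unfolding g_def using dicyclic_relations_mult[OF A B sq conj] .
  have A_pow_eq: "A [^]\<^bsub>G\<^esub> i = A [^]\<^bsub>G\<^esub> j" if "2 ^ (s + 1) dvd i - j" for i j :: int
    using int_pow_eq[OF A] dvd_trans[OF ord that] by (simp add: dvd_diff_commute)
  \<comment> \<open>Words act, group elements do not, so each element receives an explicit word.
    Reducing the exponent makes it a natural number.\<close>
  have g_word: "g i e = pres_class R
      (word_pow word_a (nat (i mod 2 ^ (s + 1))) @ (if e then word_b else []))" for i e
  proof -
    have "A [^]\<^bsub>G\<^esub> i = A [^]\<^bsub>G\<^esub> (i mod 2 ^ (s + 1))"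
      by (rule A_pow_eq) (simp add: mod_eq_dvd_iff[symmetric])
    also have "\<dots> = A [^]\<^bsub>G\<^esub> nat (i mod 2 ^ (s + 1))" by (simp add: int_pow_def2)
    also have "\<dots> = pres_class R (word_pow word_a (nat (i mod 2 ^ (s + 1))))"
      by (simp only: pres_class_word_pow A_def G_def)
    finally have "A [^]\<^bsub>G\<^esub> i = pres_class R (word_pow word_a (nat (i mod 2 ^ (s + 1))))" .
    moreover have "(if e then B else \<one>\<^bsub>G\<^esub>) = pres_class R (if e then word_b else [])"
      by (simp add: B_def G_def one_presented_group)
    ultimately show ?thesis by (simp only: g_def mult)
  qed
  \<comment> \<open>The relation for \<open>b^2\<close> is the one that needs the modulus: on pairs
    \<open>(i, True)\<close>, \<open>a^(2^s)\<close> adds \<open>2^s\<close> while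
    \<open>b^2\<close> subtracts it, a difference of \<open>2^(s+1)\<close>.\<close>
  have act_rels: "coord_cong (2 ^ (s + 1)) (word_act (2 ^ s) r p) (word_act (2 ^ s) t p)"
    if "(r, t) \<in> R" for r t p
  proof (cases p)
    case (Pair i e)
    from that consider "r = word_pow word_a (2 ^ s)" "t = word_b @ word_b"
      | "r = word_pow word_a (2 ^ (s + 1))" "t = []"
      | "r = [(Gen_b, False)] @ word_a @ word_b" "t = [(Gen_a, False)]"
      by (auto simp: R_def numeral_2_eq_2 word_inv_def)
    then show ?thesis
      by cases (auto simp: Pair coord_cong_def letter_act_pow_a simp del: power_Suc replicate.simps)
  qed
  have g_eq_iff: "g i e = g j f \<longleftrightarrow> e = f \<and> 2 ^ (s + 1) dvd i - j" for i e j f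
  proof
    \<comment> \<open>Both words are applied to \<open>(0, False)\<close>, the coordinates of the
      identity. The results are the coordinates of the elements, with exponents reduced modulo
      \<open>2^(s+1)\<close>.\<close>
    assume "g i e = g j f"
    then have "coord_cong (2 ^ (s + 1))
        (word_act (2 ^ s) (word_pow word_a (nat (i mod 2 ^ (s + 1))) @ (if e then word_b else [])) (0, False))
        (word_act (2 ^ s) (word_pow word_a (nat (j mod 2 ^ (s + 1))) @ (if f then word_b else [])) (0, False))"
      unfolding g_word pres_class_eq_iff using act_rels by (rule pres_eq_word_act)
    then have "coord_cong (2 ^ (s + 1)) (i mod 2 ^ (s + 1), e) (j mod 2 ^ (s + 1), f)"
      by (cases e; cases f) (simp_all add: letter_act_pow_a del: power_Suc)
    then show "e = f \<and> 2 ^ (s + 1) dvd i - j"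
      by (simp add: coord_cong_def mod_eq_dvd_iff[symmetric] del: power_Suc)
  next
    assume "e = f \<and> 2 ^ (s + 1) dvd i - j"
    then show "g i e = g j f" using A_pow_eq by (simp add: g_def)
  qed
  have g_closed: "g i e \<in> carrier G" for i e by (simp add: g_def)
  have one: "\<one>\<^bsub>G\<^esub> = g 0 False" by (simp add: g_def)
  have letter: "\<exists>i e. pres_class R [l] = g i e" for l
  proof -
    have gA: "A = g 1 False" and gB: "B = g 0 True" by (simp_all add: g_def)
    have "inv\<^bsub>G\<^esub> A = g (- 1) False"
      by (rule inv_equality) (simp_all add: gA g_mult one g_closed)
    moreover have "inv\<^bsub>G\<^esub> B = g (2 ^ s) True"
      by (rule inv_equality) (simp_all add: gB g_mult one g_closed g_eq_iff)
    moreover have "pres_class R [(x, False)] = inv\<^bsub>G\<^esub> (pres_class R [(x, True)])" for x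
      using pres_class_word_inv[of R "[(x, True)]"] by (simp add: word_inv_def G_def)
    ultimately have letters:
      "pres_class R [(Gen_a, True)] = g 1 False" "pres_class R [(Gen_a, False)] = g (- 1) False"
      "pres_class R [(Gen_b, True)] = g 0 True" "pres_class R [(Gen_b, False)] = g (2 ^ s) True"
      using gA gB by (simp_all only: A_def B_def)
    obtain x d where l: "l = (x, d)" by (cases l)
    show ?thesis unfolding l by (cases x; cases d) (use letters in auto)
  qed
  \<comment> \<open>Every word is brought into normal form one letter at a time, so \<open>g\<close>
    reaches the whole carrier.\<close>
  have word: "\<exists>i e. pres_class R w = g i e" for w
  proof (induction w)
    case Nil
    show ?case using one by (auto simp: G_def one_presented_group)
  next
    case (Cons l w)
    have "pres_class R (l # w) = pres_class R [l] \<otimes>\<^bsub>G\<^esub> pres_class R w" by (simp add: mult)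
    then show ?case using letter[of l] Cons.IH g_mult by metis
  qed
  have "carrier G = range (pres_class R)" by (simp add: G_def presented_group_def)
  then have carrier_iff: "x \<in> carrier G \<longleftrightarrow> (\<exists>i e. x = g i e)" for x
    using word g_closed by auto
  have "quaternion_coords G g s"
    by unfold_locales (fact carrier_iff g_eq_iff g_mult)+
  then show ?thesis using G_eq by auto
qed

theorem theorem3p3p6:
  fixes n :: nat
  assumes "n \<ge> 3"
  shows "cdeg (gen_quaternion n) =
    (2 ^ (n - 2) + real n) / (2 ^ (n - 1) + real n - 1)"
proof -
  define s where "s = n - 2"
  have n: "n = s + 2" using assms by (simp add: s_def)
  obtain g where "quaternion_coords (gen_quaternion n) g s"
    using gen_quaternion_coords n by blast
  then show ?thesis
    using quaternion_coords.cdeg_eq n by fastforce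
qed

end
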